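(* Let $n$ be a positive integer. The cardinality $\eta_n$ of the set of all disjoint non-ordered pairs of $n^2\times n^2$ S-permutation matrices is equal to $$\eta_n=\frac{(n!)^{2n}}{2}\,\xi_n,$$ where $$\xi_n=(n!)^{2n}+\sum_{k=1}^{n^2}(-1)^k\left(\sum_{\overline{g}\in\overline{\mathfrak{G}}_{n,k}}|\overline{g}|\left(\prod_{i=0}^{n-2}\left[(n-i)!\right]^{\psi_i(\overline{g})}\right)\right).$$
   Context: A binary matrix is a matrix with all entries in $\{0,1\}$. An $n^2\times n^2$ matrix is divided by $n-1$ horizontal and $n-1$ vertical lines into $n^2$ non-intersecting $n\times n$ square sub-matrices $A_{kl}$, $1\le k,l\le n$, called blocks. An $n^2\times n^2$ binary matrix is an S-permutation matrix if each row, each column and each block contains exactly one $1$. Two binary matrices $A=(a_{ij})$ and $B=(b_{ij})$ of the same size are disjoint if there are no indices $i,j$ with $a_{ij}=b_{ij}=1$. For $0\le k\le n^2$, $\mathfrak{G}_{n,k}$ denotes the set of all bipartite graphs $g=\langle R_g\cup C_g,E_g\rangle$ without multiple edges on the fixed disjoint vertex sets $R_g=\{r_1,\dots,r_n\}$, $C_g=\{c_1,\dots,c_n\}$, with $E_g\subseteq R_g\times C_g$ and $|E_g|=k$. Two such graphs $g',g''$ are isomorphic, $g'\cong g''$, if there are bijections $\rho:R_{g'}\to R_{g''}$ and $\sigma:C_{g'}\to C_{g''}$ such that $\langle r,c\rangle\in E_{g'}\iff\langle\rho(r),\sigma(c)\rangle\in E_{g''}$ (in particular the two sides are not interchanged).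 $\overline{\mathfrak{G}}_{n,k}$ is the set of equivalence classes of $\mathfrak{G}_{n,k}$ under $\cong$; $\overline{g}=\{h\in\mathfrak{G}_{n,k} : h\cong g\}$ is the class of $g$ and $|\overline{g}|$ is its cardinality. For $i=0,1,\dots,n$, $\psi_i(g)$ is the number of vertices of $g$ (in $R_g\cup C_g$) incident to exactly $i$ edges; it depends only on the class, and $\psi_i(\overline{g})=\psi_i(g)$. An empty product equals $1$. *)

theory Defs
  imports Jordan_Normal_Form.Matrix Complex_Main
begin

section \<open>S-permutation matrices\<close>

definition binary_mat :: "int mat \<Rightarrow> bool" where
  "binary_mat A \<longleftrightarrow> elements_mat A \<subseteq> {0, 1}"

text \<open>The block in block row k and block column l, where k and l count from 0.\<close>

definition block :: "nat \<Rightarrow> int mat \<Rightarrow> nat \<Rightarrow> nat \<Rightarrow> int mat" where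
  "block n A k l = mat n n (\<lambda>(i, j). A $$ (k * n + i, l * n + j))"

definition S_permutation_mats :: "nat \<Rightarrow> int mat set" where
  "S_permutation_mats n = {A \<in> carrier_mat (n^2) (n^2). binary_mat A
     \<and> (\<forall>i<n^2. \<exists>!j. j < n^2 \<and> A $$ (i, j) = 1)
     \<and> (\<forall>j<n^2. \<exists>!i. i < n^2 \<and> A $$ (i, j) = 1)
     \<and> (\<forall>k<n. \<forall>l<n. \<exists>!p. p \<in> {..<n} \<times> {..<n} \<and> block n A k l $$ p = 1)}"

text \<open>Only used for matrices of the same size.\<close>

definition disjoint_mats :: "int mat \<Rightarrow> int mat \<Rightarrow> bool" where
  "disjoint_mats A B \<longleftrightarrow>
     \<not> (\<exists>i<dim_row A. \<exists>j<dim_col A. A $$ (i, j) = 1 \<and> B $$ (i, j) = 1)"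

definition eta :: "nat \<Rightarrow> nat" where
  "eta n = card {{A, B} | A B. A \<in> S_permutation_mats n \<and> B \<in> S_permutation_mats n
                               \<and> disjoint_mats A B}"

section \<open>Bipartite graphs on fixed vertex sets\<close>

datatype vertex = Row_Vertex nat | Col_Vertex nat

definition row_vertices :: "nat \<Rightarrow> vertex set" where
  "row_vertices n = Row_Vertex ` {1..n}"

definition col_vertices :: "nat \<Rightarrow> vertex set" where
  "col_vertices n = Col_Vertex ` {1..n}"

text \<open>As the vertex sets are fixed, a graph is given by its set of edges.\<close>

type_synonym graph = "(vertex \<times> vertex) set"

definition bip_graphs :: "nat \<Rightarrow> nat \<Rightarrow> graph set" where
  "bip_graphs n k = {E. E \<subseteq> row_vertices n \<times> col_vertices n \<and> card E = k}"

definition bip_iso :: "nat \<Rightarrow> graph \<Rightarrow> graph \<Rightarrow> bool" where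
  "bip_iso n g h \<longleftrightarrow> (\<exists>\<rho> \<sigma>. bij_betw \<rho> (row_vertices n) (row_vertices n)
     \<and> bij_betw \<sigma> (col_vertices n) (col_vertices n)
     \<and> (\<forall>r\<in>row_vertices n. \<forall>c\<in>col_vertices n. (r, c) \<in> g \<longleftrightarrow> (\<rho> r, \<sigma> c) \<in> h))"

definition iso_rel :: "nat \<Rightarrow> nat \<Rightarrow> graph rel" where
  "iso_rel n k = {(g, h). g \<in> bip_graphs n k \<and> h \<in> bip_graphs n k \<and> bip_iso n g h}"

definition graph_classes :: "nat \<Rightarrow> nat \<Rightarrow> graph set set" where
  "graph_classes n k = bip_graphs n k // iso_rel n k"

definition vertex_degree :: "graph \<Rightarrow> vertex \<Rightarrow> nat" where
  "vertex_degree g v = card {e \<in> g. fst e = v \<or> snd e = v}"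

definition psi :: "nat \<Rightarrow> nat \<Rightarrow> graph \<Rightarrow> nat" where
  "psi n i g = card {v \<in> row_vertices n \<union> col_vertices n. vertex_degree g v = i}"

text \<open>The common value of psi on the members of a class; see \<open>psi_class_eq\<close> below.\<close>

definition psi_class :: "nat \<Rightarrow> nat \<Rightarrow> graph set \<Rightarrow> nat" where
  "psi_class n i X = the_elem (psi n i ` X)"

text \<open>The product ranges over \<open>0 \<le> i \<le> n - 2\<close>; writing the bound as \<open>i < n - 1\<close> keeps it
  empty for \<open>n = 1\<close>, where \<open>n - 2\<close> would truncate to 0.\<close>

definition xi :: "nat \<Rightarrow> real" where
  "xi n = fact n ^ (2 * n) + (\<Sum>k=1..n^2. (-1) ^ k *
     (\<Sum>X\<in>graph_classes n k. real (card X) * (\<Prod>i<n - 1. fact (n - i) ^ psi_class n i X)))"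

section \<open>Well-definedness\<close>

lemma equiv_iso_rel: "equiv (bip_graphs n k) (iso_rel n k)"
proof (rule equivI)
  show "iso_rel n k \<subseteq> bip_graphs n k \<times> bip_graphs n k"
    by (auto simp: iso_rel_def)
  show "refl_on (bip_graphs n k) (iso_rel n k)"
  proof (rule refl_onI)
    fix g assume "g \<in> bip_graphs n k"
    moreover have "bip_iso n g g"
      unfolding bip_iso_def by (rule exI[of _ id], rule exI[of _ id]) simp
    ultimately show "(g, g) \<in> iso_rel n k" by (simp add: iso_rel_def)
  qed
  show "sym (iso_rel n k)"
  proof (rule symI)
    fix g h assume "(g, h) \<in> iso_rel n k"
    then obtain \<rho> \<sigma> where gh: "g \<in> bip_graphs n k" "h \<in> bip_graphs n k"
      and \<rho>: "bij_betw \<rho> (row_vertices n) (row_vertices n)"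
      and \<sigma>: "bij_betw \<sigma> (col_vertices n) (col_vertices n)"
      and E: "\<forall>r\<in>row_vertices n. \<forall>c\<in>col_vertices n. (r, c) \<in> g \<longleftrightarrow> (\<rho> r, \<sigma> c) \<in> h"
      by (auto simp: iso_rel_def bip_iso_def)
    let ?\<rho> = "inv_into (row_vertices n) \<rho>" and ?\<sigma> = "inv_into (col_vertices n) \<sigma>"
    have "(r, c) \<in> h \<longleftrightarrow> (?\<rho> r, ?\<sigma> c) \<in> g"
      if "r \<in> row_vertices n" "c \<in> col_vertices n" for r c
      using that E bij_betw_inv_into_right[OF \<rho>] bij_betw_inv_into_right[OF \<sigma>]
        bij_betwE[OF bij_betw_inv_into[OF \<rho>]] bij_betwE[OF bij_betw_inv_into[OF \<sigma>]]
      by simp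
    then show "(h, g) \<in> iso_rel n k"
      using gh bij_betw_inv_into[OF \<rho>] bij_betw_inv_into[OF \<sigma>]
      unfolding iso_rel_def bip_iso_def by blast
  qed
  show "trans (iso_rel n k)"
  proof (rule transI)
    fix f g h assume "(f, g) \<in> iso_rel n k" "(g, h) \<in> iso_rel n k"
    then obtain \<rho> \<sigma> \<rho>' \<sigma>' where fh: "f \<in> bip_graphs n k" "h \<in> bip_graphs n k"
      and b: "bij_betw \<rho> (row_vertices n) (row_vertices n)"
        "bij_betw \<sigma> (col_vertices n) (col_vertices n)"
        "bij_betw \<rho>' (row_vertices n) (row_vertices n)"
        "bij_betw \<sigma>' (col_vertices n) (col_vertices n)"
      and E: "\<forall>r\<in>row_vertices n. \<forall>c\<in>col_vertices n. (r, c) \<in> f \<longleftrightarrow> (\<rho> r, \<sigma> c) \<in> g"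
        "\<forall>r\<in>row_vertices n. \<forall>c\<in>col_vertices n. (r, c) \<in> g \<longleftrightarrow> (\<rho>' r, \<sigma>' c) \<in> h"
      by (auto simp: iso_rel_def bip_iso_def)
    have "(r, c) \<in> f \<longleftrightarrow> ((\<rho>' \<circ> \<rho>) r, (\<sigma>' \<circ> \<sigma>) c) \<in> h"
      if "r \<in> row_vertices n" "c \<in> col_vertices n" for r c
      using that E bij_betwE[OF b(1)] bij_betwE[OF b(2)] by simp
    then show "(f, h) \<in> iso_rel n k"
      using fh bij_betw_trans[OF b(1,3)] bij_betw_trans[OF b(2,4)]
      unfolding iso_rel_def bip_iso_def by blast
  qed
qed

lemma psi_iso:
  assumes "(g, h) \<in> iso_rel n k"
  shows "psi n i g = psi n i h"
proof -
  obtain \<rho> \<sigma> where gh: "g \<subseteq> row_vertices n \<times> col_vertices n" "h \<subseteq> row_vertices n \<times> col_vertices n"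
    and \<rho>: "bij_betw \<rho> (row_vertices n) (row_vertices n)"
    and \<sigma>: "bij_betw \<sigma> (col_vertices n) (col_vertices n)"
    and E: "\<forall>r\<in>row_vertices n. \<forall>c\<in>col_vertices n. (r, c) \<in> g \<longleftrightarrow> (\<rho> r, \<sigma> c) \<in> h"
    using assms by (auto simp: iso_rel_def bip_iso_def bip_graphs_def)
  define V where "V = row_vertices n \<union> col_vertices n"
  define \<tau> where "\<tau> v = (if v \<in> row_vertices n then \<rho> v else \<sigma> v)" for v
  have disj: "row_vertices n \<inter> col_vertices n = {}"
    by (auto simp: row_vertices_def col_vertices_def)
  have \<tau>r: "\<tau> v = \<rho> v" if "v \<in> row_vertices n" for v using that by (simp add: \<tau>_def)
  have \<tau>c: "\<tau> v = \<sigma> v" if "v \<in> col_vertices n" for v using that disj by (auto simp: \<tau>_def)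
  have br: "bij_betw \<tau> (row_vertices n) (row_vertices n)"
    using \<rho> \<tau>r by (simp cong: bij_betw_cong)
  have bc: "bij_betw \<tau> (col_vertices n) (col_vertices n)"
    using \<sigma> \<tau>c by (simp cong: bij_betw_cong)
  have b: "bij_betw \<tau> V V"
    unfolding V_def using bij_betw_combine[OF br bc disj] .
  have inj: "\<tau> x = \<tau> y \<longleftrightarrow> x = y" if "x \<in> V" "y \<in> V" for x y
    using b that by (auto simp: bij_betw_def inj_on_def)
  have gV: "fst e \<in> V" "snd e \<in> V" if "e \<in> g" for e using that gh by (auto simp: V_def)
  have deg: "vertex_degree h (\<tau> v) = vertex_degree g v" if v: "v \<in> V" for v
  proof -
    have "map_prod \<tau> \<tau> ` {e \<in> g. fst e = v \<or> snd e = v} = {e \<in> h. fst e = \<tau> v \<or> snd e = \<tau> v}"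
      (is "?f ` ?A = ?B")
    proof (intro equalityI subsetI)
      fix e assume "e \<in> ?f ` ?A"
      then obtain r c where rc: "(r, c) \<in> g" "r = v \<or> c = v" "e = (\<tau> r, \<tau> c)" by auto
      moreover have "r \<in> row_vertices n" "c \<in> col_vertices n" using rc gh by auto
      ultimately show "e \<in> ?B" using E \<tau>r \<tau>c by auto
    next
      fix e assume e: "e \<in> ?B"
      then obtain r' c' where e': "e = (r', c')" "r' \<in> row_vertices n" "c' \<in> col_vertices n"
        using gh by (cases e) auto
      obtain r c where rc: "r \<in> row_vertices n" "r' = \<tau> r" "c \<in> col_vertices n" "c' = \<tau> c"
        using e' br bc by (metis bij_betw_imp_surj_on imageE)
      have "(r, c) \<in> g" using e e' rc E \<tau>r \<tau>c by auto
      moreover have "r = v \<or> c = v"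
        using e e' rc inj[OF _ v] by (auto simp: V_def)
      ultimately show "e \<in> ?f ` ?A" using e' rc by force
    qed
    moreover have "inj_on ?f ?A"
      by (rule inj_onI) (use inj gV in \<open>force simp: prod_eq_iff\<close>)
    ultimately show ?thesis unfolding vertex_degree_def using card_image[of ?f ?A] by simp
  qed
  have "\<tau> ` {v \<in> V. vertex_degree g v = i} = {v \<in> V. vertex_degree h v = i}"
  proof (intro equalityI subsetI)
    fix v assume "v \<in> \<tau> ` {v \<in> V. vertex_degree g v = i}"
    then show "v \<in> {v \<in> V. vertex_degree h v = i}" using deg bij_betwE[OF b] by auto
  next
    fix v assume v: "v \<in> {v \<in> V. vertex_degree h v = i}"
    then have "v \<in> \<tau> ` V" using bij_betw_imp_surj_on[OF b] by simp
    then obtain u where "u \<in> V" "v = \<tau> u" by blast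
    then show "v \<in> \<tau> ` {v \<in> V. vertex_degree g v = i}" using v deg by auto
  qed
  moreover have "inj_on \<tau> {v \<in> V. vertex_degree g v = i}"
    by (rule inj_on_subset[OF bij_betw_imp_inj_on[OF b]]) auto
  ultimately show ?thesis
    unfolding psi_def V_def[symmetric] using card_image[of \<tau> "{v \<in> V. vertex_degree g v = i}"] by simp
qed

lemma psi_class_eq:
  assumes "X \<in> graph_classes n k" "g \<in> X"
  shows "psi_class n i X = psi n i g"
proof -
  have "psi n i h = psi n i g" if "h \<in> X" for h
    using assms that quotient_eq_iff[OF equiv_iso_rel, of X n k X g h] psi_iso
    by (metis graph_classes_def)
  then have "psi n i ` X = {psi n i g}" using assms(2) by blast
  then show ?thesis by (simp add: psi_class_def)
qed

end

theory Submission
  imports Defs "HOL-Combinatorics.Permutations"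
begin

text \<open>An S-permutation matrix amounts to n permutations for the block rows and n for the block
  columns, so there are \<open>(n!)\<^bsup>2n\<^esup>\<close> of them. Fix one, A. The blocks (k, l) in which another one, B,
  has its 1 in the same place as A form the edge set of a bipartite graph, and A and B are
  disjoint iff this graph is empty. The matrices B agreeing with A on a given edge set E number
  \<open>\<Prod>v. (n - deg v)!\<close>, since each vertex stands for a permutation with \<open>deg v\<close> prescribed values.
  Inclusion-exclusion over E yields \<open>\<xi>\<^sub>n\<close>; no matrix is disjoint from itself, so passing to
  unordered pairs halves the count.\<close>

section \<open>Counting tools: permutations, alternating sums, unordered pairs\<close>

text \<open>Undoing \<open>a\<close> by its inverse turns prescribed values into fixed points, and
  the permutations of \<open>S\<close> that fix \<open>D\<close> pointwise are exactly those of
  \<open>S - D\<close>.\<close>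

lemma card_permutes_agreeing:
  assumes "finite S" "a permutes S" "D \<subseteq> S"
  shows "card {\<pi>. \<pi> permutes S \<and> (\<forall>x\<in>D. \<pi> x = a x)} = fact (card S - card D)"
proof -
  have "bij_betw (\<lambda>\<pi>. a \<circ> \<pi>) {\<pi>. \<pi> permutes (S - D)}
          {\<pi>. \<pi> permutes S \<and> (\<forall>x\<in>D. \<pi> x = a x)}"
  proof (rule bij_betw_byWitness[where f' = "\<lambda>\<pi>. inv_into UNIV a \<circ> \<pi>"])
    show "\<forall>\<pi>\<in>{\<pi>. \<pi> permutes (S - D)}. inv_into UNIV a \<circ> (a \<circ> \<pi>) = \<pi>"
      using permutes_inv_o[OF assms(2)] by (simp add: o_assoc)
    show "\<forall>\<pi>\<in>{\<pi>. \<pi> permutes S \<and> (\<forall>x\<in>D. \<pi> x = a x)}. a \<circ> (inv_into UNIV a \<circ> \<pi>) = \<pi>"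
      using permutes_inv_o[OF assms(2)] by (simp add: o_assoc)
    show "(\<lambda>\<pi>. a \<circ> \<pi>) ` {\<pi>. \<pi> permutes (S - D)}
            \<subseteq> {\<pi>. \<pi> permutes S \<and> (\<forall>x\<in>D. \<pi> x = a x)}"
    proof clarsimp
      fix \<pi> assume \<pi>: "\<pi> permutes (S - D)"
      then have "\<pi> permutes S" by (rule permutes_subset) auto
      then have "a \<circ> \<pi> permutes S" using assms(2) by (rule permutes_compose)
      moreover have "\<pi> x = x" if "x \<in> D" for x using permutes_not_in[OF \<pi>] that by simp
      ultimately show "a \<circ> \<pi> permutes S \<and> (\<forall>x\<in>D. a (\<pi> x) = a x)" by simp
    qed
    show "(\<lambda>\<pi>. inv_into UNIV a \<circ> \<pi>) ` {\<pi>. \<pi> permutes S \<and> (\<forall>x\<in>D. \<pi> x = a x)}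
            \<subseteq> {\<pi>. \<pi> permutes (S - D)}"
    proof clarsimp
      fix \<pi> assume \<pi>: "\<pi> permutes S" "\<forall>x\<in>D. \<pi> x = a x"
      have "inv_into UNIV a \<circ> \<pi> permutes S" using \<pi>(1) permutes_inv[OF assms(2)] by (rule permutes_compose)
      moreover have "(inv_into UNIV a \<circ> \<pi>) x = x" if "x \<in> S - (S - D)" for x
        using that \<pi>(2) permutes_inverses(2)[OF assms(2)] by simp
      ultimately show "inv_into UNIV a \<circ> \<pi> permutes (S - D)"
        by (rule permutes_superset) blast
    qed
  qed
  then have "card {\<pi>. \<pi> permutes S \<and> (\<forall>x\<in>D. \<pi> x = a x)} = card {\<pi>. \<pi> permutes (S - D)}"
    by (simp add: bij_betw_same_card)
  also have "\<dots> = fact (card S - card D)"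
    using assms by (intro card_permutations) (auto simp: card_Diff_subset finite_subset)
  finally show ?thesis .
qed

text \<open>Inclusion-exclusion is an involution, so it suffices to transform in the opposite
  direction: the indicator of the empty set goes to the constant 1, because only the empty subset
  contributes.\<close>

lemma alternating_sum_Pow:
  assumes "finite S"
  shows "(\<Sum>T\<in>Pow S. (- 1) ^ card T) = (if S = {} then 1 else (0 :: 'a :: ring_1))"
proof -
  have "(\<Sum>T\<in>Pow U. (- 1) ^ card T * (if T = {} then 1 else 0)) = (1 :: 'a)"
    if "finite U" for U :: "'b set"
    using that by (subst sum.remove[of _ "{}"]) (auto intro!: sum.neutral)
  then show ?thesis
    using assms inclusion_exclusion_symmetric[of "\<lambda>_. 1 :: 'a" "\<lambda>T. if T = {} then 1 else 0" S]
    by simp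
qed

text \<open>Each fibre of the map from ordered to unordered pairs has exactly two members: symmetry
  supplies the second, and irreflexivity keeps the two apart.\<close>

lemma card_unordered_pairs:
  assumes "finite P" and sym: "\<And>x y. (x, y) \<in> P \<Longrightarrow> (y, x) \<in> P" and irr: "\<And>x. (x, x) \<notin> P"
  shows "card P = 2 * card {{x, y} | x y. (x, y) \<in> P}"
proof -
  let ?f = "\<lambda>(x, y). {x, y}"
  have U: "{{x, y} | x y. (x, y) \<in> P} = ?f ` P" by force
  have "card P = (\<Sum>X\<in>?f ` P. card {z \<in> P. ?f z = X})"
    using sum.image_gen[OF assms(1), of "\<lambda>_. 1 :: nat" ?f] by simp
  also have "\<dots> = (\<Sum>X\<in>?f ` P. 2)"
  proof (rule sum.cong)
    fix X assume "X \<in> ?f ` P"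
    then obtain x y where xy: "(x, y) \<in> P" "X = {x, y}" by auto
    then have "{z \<in> P. ?f z = X} = {(x, y), (y, x)}"
      using sym by (auto simp: doubleton_eq_iff)
    moreover have "x \<noteq> y" using xy irr by blast
    ultimately show "card {z \<in> P. ?f z = X} = 2" by simp
  qed simp
  finally show ?thesis by (simp add: U)
qed

section \<open>Coding S-permutation matrices by families of permutations\<close>

text \<open>Extensionality makes a family depend on its \<open>n\<close> members alone, so that
  families can be counted as a finite product.\<close>

definition perm_families :: "nat \<Rightarrow> (nat \<Rightarrow> nat \<Rightarrow> nat) set" where
  "perm_families n = {..<n} \<rightarrow>\<^sub>E {\<pi>. \<pi> permutes {..<n}}"

lemma finite_perm_families: "finite (perm_families n)"
  unfolding perm_families_def by (intro finite_PiE) (auto simp: finite_permutations)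

lemma perm_families_permutes: "p \<in> perm_families n \<Longrightarrow> k < n \<Longrightarrow> p k permutes {..<n}"
  by (auto simp: perm_families_def)

text \<open>The conditions for different \<open>k\<close> are independent, so the set is again a
  product, to which \<open>card_permutes_agreeing\<close> applies factor by factor.\<close>

lemma card_perm_families_agreeing:
  assumes "p \<in> perm_families n" "\<And>k. k < n \<Longrightarrow> D k \<subseteq> {..<n}"
  shows "card {p' \<in> perm_families n. \<forall>k<n. \<forall>l\<in>D k. p' k l = p k l}
    = (\<Prod>k<n. fact (n - card (D k)))"
proof -
  have "{p' \<in> perm_families n. \<forall>k<n. \<forall>l\<in>D k. p' k l = p k l}
      = (\<Pi>\<^sub>E k\<in>{..<n}. {\<pi>. \<pi> permutes {..<n} \<and> (\<forall>l\<in>D k. \<pi> l = p k l)})"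
    unfolding perm_families_def set_eq_iff mem_Collect_eq PiE_iff by blast
  then show ?thesis
    using assms by (simp add: card_PiE card_permutes_agreeing perm_families_permutes)
qed

lemma card_perm_families: "card (perm_families n) = fact n ^ n"
  by (simp add: perm_families_def card_PiE card_permutations[OF refl])

text \<open>In block (k, l) the 1 sits in row \<open>p k l\<close> and column \<open>q l k\<close>: the rows of block row k
  demand that \<open>p k\<close> be a permutation, the columns of block column l that \<open>q l\<close> be one.\<close>

definition coded_mat :: "nat \<Rightarrow> (nat \<Rightarrow> nat \<Rightarrow> nat) \<times> (nat \<Rightarrow> nat \<Rightarrow> nat) \<Rightarrow> int mat" where
  "coded_mat n = (\<lambda>(p, q). mat (n^2) (n^2) (\<lambda>(r, c).
     if p (r div n) (c div n) = r mod n \<and> q (c div n) (r div n) = c mod n then 1 else 0))"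

lemma grid_less: "k < n \<Longrightarrow> i < n \<Longrightarrow> k * n + i < n^2" for k i n :: nat
proof -
  assume "k < n" "i < n"
  then have "k * n + i < Suc k * n" by simp
  also have "\<dots> \<le> n * n" using \<open>k < n\<close> by (intro mult_le_mono1) simp
  finally show ?thesis by (simp add: power2_eq_square)
qed

lemma grid_div_less: "r < n^2 \<Longrightarrow> r div n < n" for r n :: nat
  by (simp add: less_mult_imp_div_less power2_eq_square)

lemma grid_cases:
  fixes r n :: nat
  assumes "r < n^2"
  obtains k i where "k < n" "i < n" "r = k * n + i"
proof -
  have "n > 0" using assms by (cases n) auto
  then show thesis using that[of "r div n" "r mod n"] grid_div_less[OF assms] by simp
qed

lemma coded_mat_index:
  assumes "k < n" "i < n" "l < n" "j < n"
  shows "coded_mat n (p, q) $$ (k * n + i, l * n + j) = (if p k l = i \<and> q l k = j then 1 else 0)"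
  using assms by (simp add: coded_mat_def grid_less)

lemma coded_mat_carrier: "coded_mat n x \<in> carrier_mat (n^2) (n^2)"
  by (simp add: coded_mat_def split: prod.split)

lemma coded_mat_S_permutation:
  assumes p: "p \<in> perm_families n" and q: "q \<in> perm_families n"
  shows "coded_mat n (p, q) \<in> S_permutation_mats n" (is "?A \<in> _")
proof -
  note perm = perm_families_permutes[OF p] perm_families_permutes[OF q]
  have lt: "p k l < n" "q k l < n" if "k < n" "l < n" for k l
    using perm[OF that(1)] that(2) permutes_in_image by fastforce+
  have "binary_mat ?A"
    by (auto simp: binary_mat_def elements_mat_def coded_mat_def)
  moreover have "\<exists>!c. c < n^2 \<and> ?A $$ (r, c) = 1" if "r < n^2" for r
  proof -
    obtain k i where r: "k < n" "i < n" "r = k * n + i" using grid_cases \<open>r < n^2\<close> .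
    \<comment> \<open>\<open>p k\<close> is onto, so in some block column \<open>l\<close> the 1
      sits in row \<open>i\<close>; inside that block the column offset is \<open>q l k\<close>.
      Injectivity of \<open>p k\<close> will make \<open>l\<close> unique.\<close>
    obtain l where l: "l < n" "p k l = i"
      using permutes_image[OF perm(1)[OF r(1)]] r(2) by (metis imageE lessThan_iff)
    show ?thesis
    proof (intro ex1I[of _ "l * n + q l k"] conjI)
      show "l * n + q l k < n^2" "?A $$ (r, l * n + q l k) = 1"
        using r l lt by (simp_all add: grid_less coded_mat_index)
      fix c assume c: "c < n^2 \<and> ?A $$ (r, c) = 1"
      obtain l' j where c': "l' < n" "j < n" "c = l' * n + j" using grid_cases c by blast
      then have "p k l' = i" "q l' k = j"
        using c r by (auto simp: coded_mat_index split: if_splits)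
      moreover from this have "l' = l"
        using l permutes_inj[OF perm(1)[OF r(1)]] by (metis injD)
      ultimately show "c = l * n + q l k" using c' by simp
    qed
  qed
  moreover have "\<exists>!r. r < n^2 \<and> ?A $$ (r, c) = 1" if "c < n^2" for c
  proof -
    obtain l j where c: "l < n" "j < n" "c = l * n + j" using grid_cases \<open>c < n^2\<close> .
    obtain k where k: "k < n" "q l k = j"
      using permutes_image[OF perm(2)[OF c(1)]] c(2) by (metis imageE lessThan_iff)
    show ?thesis
    proof (intro ex1I[of _ "k * n + p k l"] conjI)
      show "k * n + p k l < n^2" "?A $$ (k * n + p k l, c) = 1"
        using c k lt by (simp_all add: grid_less coded_mat_index)
      fix r assume r: "r < n^2 \<and> ?A $$ (r, c) = 1"
      obtain k' i where r': "k' < n" "i < n" "r = k' * n + i" using grid_cases r by blast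
      then have "p k' l = i" "q l k' = j"
        using c r by (auto simp: coded_mat_index split: if_splits)
      moreover from this have "k' = k"
        using k permutes_inj[OF perm(2)[OF c(1)]] by (metis injD)
      ultimately show "r = k * n + p k l" using r' by simp
    qed
  qed
  moreover have "\<exists>!z. z \<in> {..<n} \<times> {..<n} \<and> block n ?A k l $$ z = 1" if "k < n" "l < n" for k l
    using that lt
    by (intro ex1I[of _ "(p k l, q l k)"]) (auto simp: block_def coded_mat_index split: if_splits)
  ultimately show ?thesis
    using coded_mat_carrier by (simp add: S_permutation_mats_def)
qed

text \<open>The position of the 1 in each block gives back \<open>p k l\<close> and
  \<open>q l k\<close>. All other values are forced: permutations fix everything outside
  \<open>{..<n}\<close>, and families are extensional.\<close>

lemma coded_mat_inj: "inj_on (coded_mat n) (perm_families n \<times> perm_families n)"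
proof (rule inj_onI, clarify)
  fix p q p' q'
  assume fam: "p \<in> perm_families n" "q \<in> perm_families n" "p' \<in> perm_families n" "q' \<in> perm_families n"
    and eq: "coded_mat n (p, q) = coded_mat n (p', q')"
  note perm = fam[THEN perm_families_permutes]
  have lt: "p k l < n" "q k l < n" if "k < n" "l < n" for k l
    using perm(1,2)[OF that(1)] that(2) permutes_in_image by fastforce+
  have "p' k l = p k l \<and> q' l k = q l k" if "k < n" "l < n" for k l
    using arg_cong[OF eq, of "\<lambda>A. A $$ (k * n + p k l, l * n + q l k)"] that lt
    by (simp add: coded_mat_index split: if_splits)
  moreover have "p k l = p' k l" "q k l = q' k l" if "k < n" "\<not> l < n" for k l
    using perm[OF that(1)] that(2) by (auto simp: permutes_not_in)
  ultimately have "p k l = p' k l" "q k l = q' k l" if "k < n" for k l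
    using that by (cases "l < n"; simp)+
  then have "p k = p' k" "q k = q' k" if "k < n" for k
    using that by auto
  moreover have "h = h'" if "h \<in> perm_families n" "h' \<in> perm_families n" "\<And>k. k < n \<Longrightarrow> h k = h' k" for h h'
    using PiE_ext[OF that(1,2)[unfolded perm_families_def]] that(3) by simp
  ultimately show "p = p' \<and> q = q'" using fam by simp
qed

text \<open>The position of the 1 in each block is read off as \<open>(f k l, g k l)\<close>. A
  repeated value of \<open>f k\<close> would put two 1s in one row, and \<open>g\<close> is treated
  likewise by columns; injectivity on a finite set then yields permutations.\<close>

lemma coded_mat_surj:
  assumes "A \<in> S_permutation_mats n"
  shows "A \<in> coded_mat n ` (perm_families n \<times> perm_families n)"
proof -
  from assms have A: "A \<in> carrier_mat (n^2) (n^2)" "binary_mat A"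
    and row: "\<And>r. r < n^2 \<Longrightarrow> \<exists>!c. c < n^2 \<and> A $$ (r, c) = 1"
    and col: "\<And>c. c < n^2 \<Longrightarrow> \<exists>!r. r < n^2 \<and> A $$ (r, c) = 1"
    and blk: "\<And>k l. k < n \<Longrightarrow> l < n \<Longrightarrow> \<exists>!z. z \<in> {..<n} \<times> {..<n} \<and> block n A k l $$ z = 1"
    by (auto simp: S_permutation_mats_def)
  have "\<exists>i j. i < n \<and> j < n \<and>
      (\<forall>i'<n. \<forall>j'<n. A $$ (k * n + i', l * n + j') = 1 \<longleftrightarrow> i' = i \<and> j' = j)" if kl: "k < n" "l < n" for k l
  proof -
    obtain z where z: "z \<in> {..<n} \<times> {..<n}" "block n A k l $$ z = 1"
      "\<And>w. w \<in> {..<n} \<times> {..<n} \<Longrightarrow> block n A k l $$ w = 1 \<Longrightarrow> w = z"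
      using blk[OF kl] by (elim ex1E) blast
    show ?thesis
    proof (rule exI[of _ "fst z"], rule exI[of _ "snd z"], intro conjI allI impI)
      show "fst z < n" "snd z < n" using z(1) by auto
      fix i' j' assume "i' < n" "j' < n"
      then show "A $$ (k * n + i', l * n + j') = 1 \<longleftrightarrow> i' = fst z \<and> j' = snd z"
        using z(1,2) z(3)[of "(i', j')"] by (cases z) (auto simp: block_def)
    qed
  qed
  then obtain f g where fg: "\<And>k l. k < n \<Longrightarrow> l < n \<Longrightarrow> f k l < n \<and> g k l < n"
    and one: "\<And>k l i j. k < n \<Longrightarrow> l < n \<Longrightarrow> i < n \<Longrightarrow> j < n \<Longrightarrow>
        A $$ (k * n + i, l * n + j) = 1 \<longleftrightarrow> i = f k l \<and> j = g k l"
    by metis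
  have f_inj: "inj_on (f k) {..<n}" if k: "k < n" for k
  proof (rule inj_onI)
    fix l l' assume l: "l \<in> {..<n}" "l' \<in> {..<n}" "f k l = f k l'"
    have "A $$ (k * n + f k l, l * n + g k l) = 1" "A $$ (k * n + f k l, l' * n + g k l') = 1"
      using one fg k l by auto
    then have "l * n + g k l = l' * n + g k l'"
      using row[of "k * n + f k l"] grid_less fg k l by (metis lessThan_iff)
    \<comment> \<open>Both offsets are below \<open>n\<close>, so division by \<open>n\<close>
      returns the block column numbers.\<close>
    then have "(l * n + g k l) div n = (l' * n + g k l') div n" by simp
    then show "l = l'" using fg k l by simp
  qed
  have g_inj: "inj_on (\<lambda>k. g k l) {..<n}" if l: "l < n" for l
  proof (rule inj_onI)
    fix k k' assume k: "k \<in> {..<n}" "k' \<in> {..<n}" "g k l = g k' l"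
    have "A $$ (k * n + f k l, l * n + g k l) = 1" "A $$ (k' * n + f k' l, l * n + g k l) = 1"
      using one fg k l by auto
    then have "k * n + f k l = k' * n + f k' l"
      using col[of "l * n + g k l"] grid_less fg k l by (metis lessThan_iff)
    then have "(k * n + f k l) div n = (k' * n + f k' l) div n" by simp
    then show "k = k'" using fg k l by simp
  qed
  have extend: "(\<lambda>x. if x < n then h x else x) permutes {..<n}"
    if "inj_on h {..<n}" "\<And>x. x < n \<Longrightarrow> h x < n" for h :: "nat \<Rightarrow> nat"
  proof (rule bij_imp_permutes)
    have "h ` {..<n} = {..<n}" using that by (intro endo_inj_surj) auto
    then have "bij_betw h {..<n} {..<n}" using that(1) by (simp add: bij_betw_def)
    then show "bij_betw (\<lambda>x. if x < n then h x else x) {..<n} {..<n}"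
      by (rule bij_betw_cong[THEN iffD1, rotated]) simp
  qed simp
  define p where "p = (\<lambda>k\<in>{..<n}. \<lambda>l. if l < n then f k l else l)"
  \<comment> \<open>\<open>g\<close> takes the block row first, whereas \<open>q\<close> is indexed
    by the block column, so the arguments change places.\<close>
  define q where "q = (\<lambda>l\<in>{..<n}. \<lambda>k. if k < n then g k l else k)"
  have "p \<in> perm_families n" "q \<in> perm_families n"
    using extend[OF f_inj] extend[OF g_inj] fg by (auto simp: perm_families_def p_def q_def)
  moreover have "A = coded_mat n (p, q)"
  proof (rule eq_matI)
    show "dim_row A = dim_row (coded_mat n (p, q))" "dim_col A = dim_col (coded_mat n (p, q))"
      using A(1) coded_mat_carrier[of n "(p, q)"] by auto
    fix r c assume "r < dim_row (coded_mat n (p, q))" "c < dim_col (coded_mat n (p, q))"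
    then have rc: "r < n^2" "c < n^2" using coded_mat_carrier[of n "(p, q)"] by auto
    obtain k i where r: "k < n" "i < n" "r = k * n + i" using grid_cases rc(1) .
    obtain l j where c: "l < n" "j < n" "c = l * n + j" using grid_cases rc(2) .
    \<comment> \<open>\<open>one\<close> locates only the 1s; every other entry is 0 because
      \<open>A\<close> is binary.\<close>
    have "A $$ (r, c) \<in> {0, 1}"
      using A rc unfolding binary_mat_def by blast
    moreover have "coded_mat n (p, q) $$ (r, c) = (if A $$ (r, c) = 1 then 1 else 0)"
      using one[of k l i j] r c by (auto simp: coded_mat_index p_def q_def)
    ultimately show "A $$ (r, c) = coded_mat n (p, q) $$ (r, c)" by auto
  qed
  ultimately show ?thesis by blast
qed

lemma bij_betw_coded_mat:
  "bij_betw (coded_mat n) (perm_families n \<times> perm_families n) (S_permutation_mats n)"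
proof (rule bij_betw_imageI[OF coded_mat_inj], rule equalityI)
  show "coded_mat n ` (perm_families n \<times> perm_families n) \<subseteq> S_permutation_mats n"
    by (clarify intro!: coded_mat_S_permutation)
  show "S_permutation_mats n \<subseteq> coded_mat n ` (perm_families n \<times> perm_families n)"
    by (rule subsetI) (rule coded_mat_surj)
qed

section \<open>The graph of blocks in which two matrices agree\<close>

text \<open>Blocks count from 0 and vertices from 1, hence \<open>Suc\<close>. The graph is defined
  on codes, where agreement is a pair of equations.\<close>

definition agreement :: "nat \<Rightarrow> (nat \<Rightarrow> nat \<Rightarrow> nat) \<times> (nat \<Rightarrow> nat \<Rightarrow> nat) \<Rightarrow>
    (nat \<Rightarrow> nat \<Rightarrow> nat) \<times> (nat \<Rightarrow> nat \<Rightarrow> nat) \<Rightarrow> graph" where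
  "agreement n = (\<lambda>(p, q) (p', q'). {(Row_Vertex (Suc k), Col_Vertex (Suc l)) | k l.
     k < n \<and> l < n \<and> p' k l = p k l \<and> q' l k = q l k})"

lemma row_vertices_altdef: "row_vertices n = (\<lambda>k. Row_Vertex (Suc k)) ` {..<n}"
  and col_vertices_altdef: "col_vertices n = (\<lambda>k. Col_Vertex (Suc k)) ` {..<n}"
  unfolding row_vertices_def col_vertices_def image_Suc_lessThan[symmetric] image_image by simp_all

lemma finite_vertices: "finite (row_vertices n)" "finite (col_vertices n)"
  by (simp_all add: row_vertices_def col_vertices_def)

lemma agreement_subset: "agreement n x y \<subseteq> row_vertices n \<times> col_vertices n"
  by (auto simp: agreement_def row_vertices_altdef col_vertices_altdef split: prod.split)

text \<open>A common 1 lies in some block, and it is the only 1 of that block in either matrix; so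
  common 1s correspond to blocks of agreement.\<close>

lemma disjoint_mats_coded_mat:
  assumes x: "x \<in> perm_families n \<times> perm_families n" and "y \<in> perm_families n \<times> perm_families n"
  shows "disjoint_mats (coded_mat n x) (coded_mat n y) \<longleftrightarrow> agreement n x y = {}"
proof -
  obtain p q p' q' where xy: "x = (p, q)" "y = (p', q')" by (cases x, cases y)
  have dim: "dim_row (coded_mat n x) = n^2" "dim_col (coded_mat n x) = n^2"
    using coded_mat_carrier[of n x] by auto
  have fam: "p \<in> perm_families n" "q \<in> perm_families n" using x xy by auto
  have lt: "p k l < n" "q k l < n" if "k < n" "l < n" for k l
    using fam[THEN perm_families_permutes, OF that(1)] that(2) permutes_in_image by fastforce+
  have "(\<exists>r<n^2. \<exists>c<n^2. coded_mat n x $$ (r, c) = 1 \<and> coded_mat n y $$ (r, c) = 1)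
      \<longleftrightarrow> (\<exists>k<n. \<exists>l<n. p' k l = p k l \<and> q' l k = q l k)" (is "?L \<longleftrightarrow> ?R")
  proof
    assume ?L
    then obtain r c where rc: "r < n^2" "c < n^2"
      "coded_mat n x $$ (r, c) = 1" "coded_mat n y $$ (r, c) = 1" by blast
    obtain k i where r: "k < n" "i < n" "r = k * n + i" using grid_cases rc(1) .
    obtain l j where c: "l < n" "j < n" "c = l * n + j" using grid_cases rc(2) .
    show ?R using rc r c xy by (auto simp: coded_mat_index split: if_splits)
  next
    assume ?R
    then obtain k l where kl: "k < n" "l < n" "p' k l = p k l" "q' l k = q l k" by blast
    then show ?L
      using lt xy
      by (intro exI[of _ "k * n + p k l"] conjI exI[of _ "l * n + q l k"])
        (simp_all add: coded_mat_index grid_less)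
  qed
  then show ?thesis
    unfolding disjoint_mats_def dim by (auto simp: agreement_def xy)
qed

section \<open>Vertex degrees and the weight of a graph\<close>

text \<open>This is the inner product of \<open>xi\<close>, at a single graph instead of at a
  class.\<close>

definition weight :: "nat \<Rightarrow> graph \<Rightarrow> nat" where
  "weight n E = (\<Prod>i<n - 1. fact (n - i) ^ psi n i E)"

lemma vertex_degree_row:
  assumes "E \<subseteq> row_vertices n \<times> col_vertices n"
  shows "vertex_degree E (Row_Vertex (Suc k)) = card {l. l < n \<and> (Row_Vertex (Suc k), Col_Vertex (Suc l)) \<in> E}"
proof -
  have "{e \<in> E. fst e = Row_Vertex (Suc k) \<or> snd e = Row_Vertex (Suc k)}
    = (\<lambda>l. (Row_Vertex (Suc k), Col_Vertex (Suc l))) ` {l. l < n \<and> (Row_Vertex (Suc k), Col_Vertex (Suc l)) \<in> E}"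
    using assms by (auto simp: row_vertices_altdef col_vertices_altdef)
  then show ?thesis
    unfolding vertex_degree_def by (simp add: card_image inj_on_def)
qed

lemma vertex_degree_col:
  assumes "E \<subseteq> row_vertices n \<times> col_vertices n"
  shows "vertex_degree E (Col_Vertex (Suc l)) = card {k. k < n \<and> (Row_Vertex (Suc k), Col_Vertex (Suc l)) \<in> E}"
proof -
  have "{e \<in> E. fst e = Col_Vertex (Suc l) \<or> snd e = Col_Vertex (Suc l)}
    = (\<lambda>k. (Row_Vertex (Suc k), Col_Vertex (Suc l))) ` {k. k < n \<and> (Row_Vertex (Suc k), Col_Vertex (Suc l)) \<in> E}"
    using assms by (auto simp: row_vertices_altdef col_vertices_altdef)
  then show ?thesis
    unfolding vertex_degree_def by (simp add: card_image inj_on_def)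
qed

lemma vertex_degree_le:
  assumes E: "E \<subseteq> row_vertices n \<times> col_vertices n" and v: "v \<in> row_vertices n \<union> col_vertices n"
  shows "vertex_degree E v \<le> n"
proof -
  have "card {k. k < n \<and> P k} \<le> n" for P
    using card_mono[of "{..<n}" "{k. k < n \<and> P k}"] by auto
  then show ?thesis
    using v vertex_degree_row[OF E] vertex_degree_col[OF E]
    by (auto simp: row_vertices_altdef col_vertices_altdef)
qed

text \<open>Vertices of degree n - 1 and n contribute the factors 1! and 0!, which \<^const>\<open>weight\<close> omits.\<close>

lemma weight_eq_prod_vertices:
  assumes E: "E \<subseteq> row_vertices n \<times> col_vertices n"
  shows "weight n E = (\<Prod>v\<in>row_vertices n \<union> col_vertices n. fact (n - vertex_degree E v))"
proof -
  let ?V = "row_vertices n \<union> col_vertices n"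
  have "(\<Prod>v\<in>?V. fact (n - vertex_degree E v) :: nat)
      = (\<Prod>i\<le>n. \<Prod>v\<in>{v \<in> ?V. vertex_degree E v = i}. fact (n - vertex_degree E v))"
    by (rule prod.group[symmetric]) (use finite_vertices vertex_degree_le[OF E] in auto)
  also have "\<dots> = (\<Prod>i\<le>n. fact (n - i) ^ psi n i E)"
    unfolding psi_def by (rule prod.cong) auto
  also have "\<dots> = (\<Prod>i<n - 1. fact (n - i) ^ psi n i E)"
  proof (rule prod.mono_neutral_right)
    show "\<forall>i\<in>{..n} - {..<n - 1}. (fact (n - i) ^ psi n i E :: nat) = 1"
    proof
      fix i assume "i \<in> {..n} - {..<n - 1}"
      then have "n - i = 0 \<or> n - i = 1" by auto
      then show "(fact (n - i) ^ psi n i E :: nat) = 1" by auto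
    qed
  qed auto
  finally show ?thesis by (simp add: weight_def)
qed

text \<open>One edge prescribes two values, that of \<open>p' k\<close> at \<open>l\<close> and that
  of \<open>q' l\<close> at \<open>k\<close>. So the two families are constrained separately, and a
  vertex of degree d leaves (n - d)! choices.\<close>

lemma card_agreement_superset:
  assumes x: "x \<in> perm_families n \<times> perm_families n" and E: "E \<subseteq> row_vertices n \<times> col_vertices n"
  shows "card {y \<in> perm_families n \<times> perm_families n. E \<subseteq> agreement n x y} = weight n E"
proof -
  obtain p q where pq: "x = (p, q)" "p \<in> perm_families n" "q \<in> perm_families n" using x by auto
  \<comment> \<open>\<open>R k\<close> and \<open>C l\<close> are the neighbourhoods of a row vertex
    and a column vertex, with indices shifted back to start from 0.\<close>
  define R where "R k = {l. l < n \<and> (Row_Vertex (Suc k), Col_Vertex (Suc l)) \<in> E}" for k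
  define C where "C l = {k. k < n \<and> (Row_Vertex (Suc k), Col_Vertex (Suc l)) \<in> E}" for l
  have sub: "E \<subseteq> agreement n x (p', q') \<longleftrightarrow>
      (\<forall>k<n. \<forall>l\<in>R k. p' k l = p k l) \<and> (\<forall>l<n. \<forall>k\<in>C l. q' l k = q l k)" (is "?L \<longleftrightarrow> ?R") for p' q'
  proof
    assume ?L then show ?R by (fastforce simp: agreement_def pq(1) R_def C_def)
  next
    assume rhs: ?R
    show ?L
    proof
      fix e assume e: "e \<in> E"
      then obtain k l where "e = (Row_Vertex (Suc k), Col_Vertex (Suc l))" "k < n" "l < n"
        using E by (auto simp: row_vertices_altdef col_vertices_altdef)
      then show "e \<in> agreement n x (p', q')"
        using rhs e by (auto simp: agreement_def pq(1) R_def C_def)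
    qed
  qed
  have "{y \<in> perm_families n \<times> perm_families n. E \<subseteq> agreement n x y}
      = {p' \<in> perm_families n. \<forall>k<n. \<forall>l\<in>R k. p' k l = p k l}
        \<times> {q' \<in> perm_families n. \<forall>l<n. \<forall>k\<in>C l. q' l k = q l k}"
    by (simp add: set_eq_iff sub conj_ac)
  then have "card {y \<in> perm_families n \<times> perm_families n. E \<subseteq> agreement n x y}
      = (\<Prod>k<n. fact (n - card (R k))) * (\<Prod>l<n. fact (n - card (C l)))"
    using card_perm_families_agreeing[OF pq(2), of R] card_perm_families_agreeing[OF pq(3), of C]
    by (simp add: card_cartesian_product R_def C_def subset_iff)
  also have "\<dots> = (\<Prod>v\<in>row_vertices n. fact (n - vertex_degree E v))
      * (\<Prod>v\<in>col_vertices n. fact (n - vertex_degree E v))"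
    using vertex_degree_row[OF E] vertex_degree_col[OF E]
    by (simp add: row_vertices_altdef col_vertices_altdef prod.reindex inj_on_def R_def C_def)
  also have "\<dots> = weight n E"
    unfolding weight_eq_prod_vertices[OF E]
    by (rule prod.union_disjoint[symmetric])
      (auto simp: finite_vertices row_vertices_def col_vertices_def)
  finally show ?thesis .
qed

text \<open>\<open>alternating_sum_Pow\<close> writes emptiness of the agreement graph as a signed
  sum over its subsets; exchanging the sums leaves for each \<open>E\<close> the number of
  \<open>y\<close> that agree with \<open>x\<close> on \<open>E\<close>.\<close>

lemma card_disjoint_codes:
  assumes x: "x \<in> perm_families n \<times> perm_families n"
  shows "real (card {y \<in> perm_families n \<times> perm_families n. agreement n x y = {}})
    = (\<Sum>E\<in>Pow (row_vertices n \<times> col_vertices n). (- 1) ^ card E * real (weight n E))"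
proof -
  let ?C = "perm_families n \<times> perm_families n" and ?U = "row_vertices n \<times> col_vertices n"
  have finC: "finite ?C" using finite_perm_families by simp
  have finU: "finite ?U" using finite_vertices by simp
  have fin: "finite (agreement n x y)" for y
    using agreement_subset finU by (rule finite_subset)
  have "real (card {y \<in> ?C. agreement n x y = {}}) = (\<Sum>y\<in>?C. if agreement n x y = {} then 1 else 0)"
    using finC by (simp add: sum.If_cases Int_def)
  also have "\<dots> = (\<Sum>y\<in>?C. \<Sum>E\<in>Pow (agreement n x y). (- 1) ^ card E)"
    by (simp only: alternating_sum_Pow[OF fin])
  \<comment> \<open>The range of \<open>E\<close> has to be independent of \<open>y\<close> before
    the sums can be exchanged.\<close>
  also have "\<dots> = (\<Sum>y\<in>?C. \<Sum>E\<in>Pow ?U. if E \<subseteq> agreement n x y then (- 1) ^ card E else 0)"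
  proof (rule sum.cong[OF refl])
    fix y
    have "Pow (agreement n x y) = {E \<in> Pow ?U. E \<subseteq> agreement n x y}"
      using agreement_subset[of n x y] by blast
    then show "(\<Sum>E\<in>Pow (agreement n x y). (- 1) ^ card E) =
        (\<Sum>E\<in>Pow ?U. if E \<subseteq> agreement n x y then (- 1) ^ card E else (0 :: real))"
      using finU by (simp only: sum.inter_filter finite_Pow_iff)
  qed
  also have "\<dots> = (\<Sum>E\<in>Pow ?U. \<Sum>y\<in>?C. if E \<subseteq> agreement n x y then (- 1) ^ card E else 0)"
    by (rule sum.swap)
  also have "\<dots> = (\<Sum>E\<in>Pow ?U. (- 1) ^ card E * real (card {y \<in> ?C. E \<subseteq> agreement n x y}))"
    using finC by (simp add: sum.inter_filter[symmetric] mult.commute)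
  also have "\<dots> = (\<Sum>E\<in>Pow ?U. (- 1) ^ card E * real (weight n E))"
    using card_agreement_superset[OF x] by (intro sum.cong) auto
  finally show ?thesis .
qed

section \<open>Grouping by isomorphism class\<close>

text \<open>The classes partition the graphs of size \<open>k\<close>, and by
  \<open>psi_class_eq\<close> the weight is constant on each, so a class contributes its cardinality
  times that weight.\<close>

lemma sum_graph_classes:
  "(\<Sum>X\<in>graph_classes n k. real (card X) * (\<Prod>i<n - 1. fact (n - i) ^ psi_class n i X))
    = (\<Sum>E\<in>bip_graphs n k. real (weight n E))"
proof -
  have fin: "finite (bip_graphs n k)"
    by (rule finite_subset[of _ "Pow (row_vertices n \<times> col_vertices n)"])
      (auto simp: bip_graphs_def finite_vertices)
  have Un: "\<Union>(graph_classes n k) = bip_graphs n k"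
    unfolding graph_classes_def by (rule Union_quotient[OF equiv_iso_rel])
  have "(\<Sum>E\<in>bip_graphs n k. real (weight n E)) = (\<Sum>X\<in>graph_classes n k. \<Sum>E\<in>X. real (weight n E))"
    unfolding Un[symmetric]
  proof (subst sum.Union_disjoint)
    show "\<forall>X\<in>graph_classes n k. finite X"
      using Un fin finite_subset by (metis Union_upper)
    show "\<forall>X\<in>graph_classes n k. \<forall>Y\<in>graph_classes n k. X \<noteq> Y \<longrightarrow> X \<inter> Y = {}"
      using quotient_disj[OF equiv_iso_rel] by (metis graph_classes_def)
  qed simp
  also have "\<dots> = (\<Sum>X\<in>graph_classes n k. \<Sum>E\<in>X. \<Prod>i<n - 1. fact (n - i) ^ psi_class n i X)"
    by (intro sum.cong refl) (simp add: weight_def psi_class_eq)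
  finally show ?thesis by simp
qed

text \<open>The edge sets are grouped by size \<open>k\<close>. For \<open>k = 0\<close> only the
  empty graph occurs; all its \<open>2 * n\<close> vertices have degree 0, which gives the leading
  term of \<open>xi\<close>.\<close>

lemma xi_eq_sum_graphs:
  "xi n = (\<Sum>E\<in>Pow (row_vertices n \<times> col_vertices n). (- 1) ^ card E * real (weight n E))"
proof -
  let ?U = "row_vertices n \<times> col_vertices n"
  have finU: "finite ?U" using finite_vertices by simp
  have cardV: "card (row_vertices n) = n" "card (col_vertices n) = n"
    by (simp_all add: row_vertices_def col_vertices_def card_image inj_on_def)
  have cardE: "card E \<le> n^2" if "E \<subseteq> ?U" for E
    using card_mono[OF finU that] by (simp add: card_cartesian_product cardV power2_eq_square)
  have "card (row_vertices n \<union> col_vertices n) = 2 * n"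
    by (subst card_Un_disjoint) (auto simp: cardV finite_vertices, auto simp: row_vertices_def col_vertices_def)
  then have "weight n {} = fact n ^ (2 * n)"
    by (simp add: weight_eq_prod_vertices vertex_degree_def)
  moreover have "bip_graphs n 0 = {{}}"
    using finite_subset[OF _ finU] by (auto simp: bip_graphs_def)
  ultimately have zero: "(\<Sum>E\<in>bip_graphs n 0. real (weight n E)) = fact n ^ (2 * n)" by simp
  have "(\<Sum>E\<in>Pow ?U. (- 1) ^ card E * real (weight n E))
      = (\<Sum>k\<le>n^2. \<Sum>E\<in>{E \<in> Pow ?U. card E = k}. (- 1) ^ card E * real (weight n E))"
    by (rule sum.group[symmetric]) (use finU cardE in auto)
  also have "\<dots> = (\<Sum>k\<le>n^2. (- 1) ^ k * (\<Sum>E\<in>bip_graphs n k. real (weight n E)))"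
    by (simp add: bip_graphs_def sum_distrib_left)
  also have "\<dots> = xi n"
    unfolding xi_def sum_graph_classes
    using sum.atLeast_Suc_atMost[of 0 "n^2" "\<lambda>k. (- 1) ^ k * (\<Sum>E\<in>bip_graphs n k. real (weight n E))"]
    by (simp add: zero atLeast0AtMost)
  finally show ?thesis ..
qed

section \<open>Counting the disjoint pairs of matrices\<close>

theorem corollary1:
  fixes n :: nat
  assumes "n > 0"
  shows "real (eta n) = fact n ^ (2 * n) / 2 * xi n"
proof -
  let ?C = "perm_families n \<times> perm_families n" and ?S = "S_permutation_mats n"
  \<comment> \<open>\<open>P\<close> holds the ordered pairs of matrices, \<open>Q\<close> the same
    pairs in terms of codes.\<close>
  define P where "P = {(A, B). A \<in> ?S \<and> B \<in> ?S \<and> disjoint_mats A B}"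
  define Q where "Q = (SIGMA x:?C. {y \<in> ?C. agreement n x y = {}})"
  have finC: "finite ?C" using finite_perm_families by simp
  have img: "coded_mat n ` ?C = ?S" and inj: "inj_on (coded_mat n) ?C"
    using bij_betw_coded_mat[of n] by (auto simp: bij_betw_def)
  have P: "P = map_prod (coded_mat n) (coded_mat n) ` Q"
  proof (intro equalityI subsetI)
    fix z assume "z \<in> P"
    then obtain x y where "x \<in> ?C" "y \<in> ?C" "z = (coded_mat n x, coded_mat n y)"
        "disjoint_mats (coded_mat n x) (coded_mat n y)"
      unfolding P_def img[symmetric] by blast
    then show "z \<in> map_prod (coded_mat n) (coded_mat n) ` Q"
      using disjoint_mats_coded_mat unfolding Q_def by force
  next
    fix z assume "z \<in> map_prod (coded_mat n) (coded_mat n) ` Q"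
    then obtain x y where xy: "x \<in> ?C" "y \<in> ?C" "z = (coded_mat n x, coded_mat n y)" "agreement n x y = {}"
      unfolding Q_def by auto
    then show "z \<in> P"
      using disjoint_mats_coded_mat[OF xy(1,2)] img unfolding P_def by blast
  qed
  have "inj_on (map_prod (coded_mat n) (coded_mat n)) Q"
    by (rule inj_on_subset[OF map_prod_inj_on[OF inj inj]]) (auto simp: Q_def)
  then have "real (card P) = real (card Q)"
    by (simp add: P card_image)
  also have "\<dots> = (\<Sum>x\<in>?C. real (card {y \<in> ?C. agreement n x y = {}}))"
    unfolding Q_def using finC by (subst card_SigmaI) auto
  also have "\<dots> = (\<Sum>x\<in>?C. xi n)"
    by (intro sum.cong refl) (simp only: card_disjoint_codes xi_eq_sum_graphs)
  also have "\<dots> = fact n ^ (2 * n) * xi n"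
    by (simp add: card_cartesian_product card_perm_families mult_2 power_add)
  finally have cardP: "real (card P) = fact n ^ (2 * n) * xi n" .
  have carrier: "A \<in> carrier_mat (n^2) (n^2)" if "A \<in> ?S" for A
    using that by (simp add: S_permutation_mats_def)
  have "card P = 2 * card {{A, B} | A B. (A, B) \<in> P}"
  proof (rule card_unordered_pairs)
    show "finite P"
      unfolding P Q_def using finC by auto
    \<comment> \<open>\<open>disjoint_mats\<close> takes its index bounds from the first matrix, so
      symmetry rests on the common size.\<close>
    show "(B, A) \<in> P" if "(A, B) \<in> P" for A B
      using that by (auto simp: P_def disjoint_mats_def dest!: carrier)
    show "(A, A) \<notin> P" for A
    proof
      assume "(A, A) \<in> P"
      then have A: "A \<in> ?S" "disjoint_mats A A" by (auto simp: P_def)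
      \<comment> \<open>There is a row 0, and its 1 is shared by \<open>A\<close> with itself; for
        \<open>n = 0\<close> the empty matrix would be disjoint from itself.\<close>
      have "0 < n^2" using assms by simp
      moreover have "\<forall>i<n^2. \<exists>!j. j < n^2 \<and> A $$ (i, j) = 1"
        using A(1) by (simp add: S_permutation_mats_def)
      ultimately obtain j where "j < n^2" "A $$ (0, j) = 1" by blast
      then show False
        using A(2) carrier[OF A(1)] \<open>0 < n^2\<close> by (auto simp: disjoint_mats_def)
    qed
  qed
  moreover have "{{A, B} | A B. (A, B) \<in> P}
      = {{A, B} | A B. A \<in> ?S \<and> B \<in> ?S \<and> disjoint_mats A B}"
    by (simp add: P_def)
  ultimately have "card P = 2 * eta n" by (simp add: eta_def)
  then show ?thesis using cardP by simp
qed

end
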